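(* Let $d$ be a degree sequence with canonical decomposition \[d=\alpha_1\circ\cdots\circ\alpha_k\circ d_0 .\] Then \[\mathscr{G}(d)\cong \mathscr{G}(\alpha_1)\,\Box\,\cdots\,\Box\,\mathscr{G}(\alpha_k)\,\Box\,\mathscr{G}(d_0),\] where $\Box$ denotes the Cartesian product of graphs.
   Context: All graphs are finite and simple; degree sequences are written in descending order. For a degree sequence $d=(d_1,\dots,d_n)$, a realization of $d$ is a graph with vertex set $\{1,\dots,n\}$ in which vertex $i$ has degree $d_i$ (realizations are distinguished by edge sets). A 2-switch in a graph replaces edges $ab,cd$ by non-edges $ad,bc$ (with $a,b,c,d$ distinct, $ab,cd$ edges and $ad,bc$ non-edges). The realization graph $\mathscr{G}(d)$ has the realizations of $d$ as vertices, two being adjacent iff one is obtained from the other by one 2-switch. A splitted sequence $(\beta;\gamma)$ is the degree sequence of a split graph with a fixed partition into a clique (degrees listed in $\beta$) and an independent set (degrees listed in $\gamma$); $\mathscr{G}((\beta;\gamma))$ means the realization graph of the sequence consisting of all terms of $\beta$ and $\gamma$. For a list $\ell$, $|\ell|$ is its length. Composition of a splitted sequence with a degree sequence: $(p_2;p_1)\circ q$ is obtained by concatenating $p_2,p_1,q$, adding $|q|$ to each term of $p_2$ and $|p_2|$ to each term of $q$, and sorting. Composition of two splitted sequences: $(p_2;p_1)\circ(r_2;r_1)$ is the splitted sequence whose clique part consists of the terms of $p_2$ each increased by $|r_2|+|r_1|$ together with the terms of $r_2$ each increased by $|p_2|$, and whose independent part consists of the terms of $r_1$ each increased by $|p_2|$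 together with the terms of $p_1$. This composition is associative. A (splitted or ordinary) degree sequence is indecomposable if it cannot be expressed as a composition of two such sequences each of strictly smaller length. By a theorem of Tyshkevich, every degree sequence $d$ can be written uniquely as $d=\alpha_1\circ\cdots\circ\alpha_k\circ d_0$ ($k\ge 0$) where each $\alpha_i=(\beta_i;\gamma_i)$ is an indecomposable splitted sequence and $d_0$ is an indecomposable degree sequence; this is the canonical decomposition of $d$. *)

theory Defs
  imports Main
begin

text \<open>A simple graph is a pair of a vertex set and a set of two-element edges.\<close>

type_synonym 'a sgraph = "'a set \<times> 'a set set"

definition simple_graph :: "'a sgraph \<Rightarrow> bool" where
  "simple_graph G \<longleftrightarrow> finite (fst G) \<and> (\<forall>e \<in> snd G. e \<subseteq> fst G \<and> card e = 2)"

definition degree :: "'a sgraph \<Rightarrow> 'a \<Rightarrow> nat" where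
  "degree G v = card {e \<in> snd G. v \<in> e}"

definition graph_iso :: "'a sgraph \<Rightarrow> 'b sgraph \<Rightarrow> bool" (infix "\<cong>\<^sub>G" 50) where
  "G \<cong>\<^sub>G H \<longleftrightarrow> (\<exists>f. bij_betw f (fst G) (fst H) \<and>
     (\<forall>u \<in> fst G. \<forall>v \<in> fst G. {u, v} \<in> snd G \<longleftrightarrow> {f u, f v} \<in> snd H))"

text \<open>The Cartesian product of a list of graphs. The vertices are the lists that pick one vertex
  from each factor; two of them are adjacent iff they are adjacent in one coordinate and agree in
  all the others.\<close>

definition cart_prod :: "'a sgraph list \<Rightarrow> 'a list sgraph" where
  "cart_prod Gs = (listset (map fst Gs),
     {{xs, ys} | xs ys. xs \<in> listset (map fst Gs) \<and> ys \<in> listset (map fst Gs) \<and>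
        (\<exists>i < length Gs. {xs ! i, ys ! i} \<in> snd (Gs ! i) \<and>
           (\<forall>j < length Gs. j \<noteq> i \<longrightarrow> xs ! j = ys ! j))})"

text \<open>A realization is identified with its edge set; the vertices of a realization of
  \<open>d\<close> are the list positions \<open>0, \<dots>, length d - 1\<close>. The list need not be sorted.\<close>

definition realizations :: "nat list \<Rightarrow> nat set set set" where
  "realizations d = {E. simple_graph ({..<length d}, E) \<and>
     (\<forall>i < length d. degree ({..<length d}, E) i = d ! i)}"

definition degree_seq :: "nat list \<Rightarrow> bool" where
  "degree_seq d \<longleftrightarrow> sorted_wrt (\<ge>) d \<and> realizations d \<noteq> {}"

definition two_switch :: "'a set set \<Rightarrow> 'a set set \<Rightarrow> bool" where
  "two_switch E E' \<longleftrightarrow> (\<exists>a b c d. distinct [a, b, c, d] \<and>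
     {a, b} \<in> E \<and> {c, d} \<in> E \<and> {a, d} \<notin> E \<and> {b, c} \<notin> E \<and>
     E' = (E - {{a, b}, {c, d}}) \<union> {{a, d}, {b, c}})"

definition realization_graph :: "nat list \<Rightarrow> nat set set sgraph" where
  "realization_graph d = (realizations d,
     {{E, E'} | E E'. E \<in> realizations d \<and> E' \<in> realizations d \<and> two_switch E E'})"

text \<open>A splitted sequence \<open>(\<beta>; \<gamma>)\<close> is a pair of descending lists; either list may be empty.\<close>

type_synonym splitted = "nat list \<times> nat list"

definition splitted_seq :: "splitted \<Rightarrow> bool" where
  "splitted_seq = (\<lambda>(\<beta>, \<gamma>). sorted_wrt (\<ge>) \<beta> \<and> sorted_wrt (\<ge>) \<gamma> \<and>
     (\<exists>E \<in> realizations (\<beta> @ \<gamma>).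
        (\<forall>u < length \<beta>. \<forall>v < length \<beta>. u \<noteq> v \<longrightarrow> {u, v} \<in> E) \<and>
        (\<forall>u \<in> {length \<beta>..<length (\<beta> @ \<gamma>)}. \<forall>v \<in> {length \<beta>..<length (\<beta> @ \<gamma>)}. {u, v} \<notin> E)))"

definition sort_desc :: "nat list \<Rightarrow> nat list" where
  "sort_desc xs = rev (sort xs)"

definition splitted_length :: "splitted \<Rightarrow> nat" where
  "splitted_length = (\<lambda>(\<beta>, \<gamma>). length \<beta> + length \<gamma>)"

definition splitted_terms :: "splitted \<Rightarrow> nat list" where
  "splitted_terms = (\<lambda>(\<beta>, \<gamma>). sort_desc (\<beta> @ \<gamma>))"

definition comp_seq :: "splitted \<Rightarrow> nat list \<Rightarrow> nat list" where
  "comp_seq = (\<lambda>(p2, p1) q.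
     sort_desc (map (\<lambda>x. x + length q) p2 @ p1 @ map (\<lambda>x. x + length p2) q))"

definition comp_splitted :: "splitted \<Rightarrow> splitted \<Rightarrow> splitted" where
  "comp_splitted = (\<lambda>(p2, p1) (r2, r1).
     (sort_desc (map (\<lambda>x. x + (length r2 + length r1)) p2 @ map (\<lambda>x. x + length p2) r2),
      sort_desc (map (\<lambda>x. x + length p2) r1 @ p1)))"

text \<open>Indecomposable sequences are required to be nonempty: otherwise empty components could be
  inserted freely and the canonical decomposition would not be unique.\<close>

definition indecomposable_seq :: "nat list \<Rightarrow> bool" where
  "indecomposable_seq d \<longleftrightarrow> degree_seq d \<and> d \<noteq> [] \<and>
     \<not> (\<exists>p q. splitted_seq p \<and> degree_seq q \<and>
          splitted_length p < length d \<and> length q < length d \<and> d = comp_seq p q)"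

definition indecomposable_splitted :: "splitted \<Rightarrow> bool" where
  "indecomposable_splitted s \<longleftrightarrow> splitted_seq s \<and> s \<noteq> ([], []) \<and>
     \<not> (\<exists>p r. splitted_seq p \<and> splitted_seq r \<and>
          splitted_length p < splitted_length s \<and> splitted_length r < splitted_length s \<and>
          s = comp_splitted p r)"

definition canonical_decomposition :: "nat list \<Rightarrow> splitted list \<Rightarrow> nat list \<Rightarrow> bool" where
  "canonical_decomposition d \<alpha>s d0 \<longleftrightarrow>
     (\<forall>\<alpha> \<in> set \<alpha>s. indecomposable_splitted \<alpha>) \<and> indecomposable_seq d0 \<and>
     d = foldr comp_seq \<alpha>s d0"

end

theory Submission
  imports Defs "HOL-Combinatorics.List_Permutation"
begin

text \<open>Let \<open>d = (\<beta>; \<gamma>) \<circ> q\<close>, with vertex classes \<open>A\<close>, \<open>B\<close>, \<open>Q\<close> corresponding to the terms of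
  \<open>\<beta>\<close>, \<open>\<gamma>\<close>, \<open>q\<close>. In any graph the difference of the degree sums over \<open>A\<close> and \<open>B\<close> is at most
  \<open>|A| (|A| - 1) + |A| |Q|\<close>, with equality only if all pairs between \<open>A\<close> and \<open>Q\<close> and no
  pairs between \<open>B\<close> and \<open>Q\<close> are edges; the degrees in \<open>d\<close> attain this bound. So the
  pairs between \<open>A \<union> B\<close> and \<open>Q\<close> have the same status in all realizations. A realization of \<open>d\<close> is
  therefore a realization of \<open>(\<beta>; \<gamma>)\<close> on \<open>A \<union> B\<close> together with one of \<open>q\<close> on \<open>Q\<close>, and since a
  2-switch alters the status of four pairs that form a 4-cycle, it takes place inside one of the two
  parts. The theorem follows by induction on the number of splitted components.\<close>

section \<open>Realization graphs over arbitrary vertex sets\<close>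

text \<open>The two parts of a composition live on different sets of list positions. With the vertex
  set and the prescribed degrees as parameters, both can be treated in place, and renumbering is
  left to \<open>realization_graph_on_relabel\<close>.\<close>

definition realizations_on :: "'a set \<Rightarrow> ('a \<Rightarrow> nat) \<Rightarrow> 'a set set set" where
  "realizations_on V f = {E. simple_graph (V, E) \<and> (\<forall>v \<in> V. degree (V, E) v = f v)}"

definition realization_graph_on :: "'a set \<Rightarrow> ('a \<Rightarrow> nat) \<Rightarrow> 'a set set sgraph" where
  "realization_graph_on V f = (realizations_on V f,
     {{E, E'} | E E'. E \<in> realizations_on V f \<and> E' \<in> realizations_on V f \<and> two_switch E E'})"

lemma realization_graph_eq:
  "realization_graph d = realization_graph_on {..<length d} ((!) d)"
  by (auto simp: realization_graph_def realization_graph_on_def realizations_def realizations_on_def)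

text \<open>The switch along \<open>a, d, c, b\<close> undoes the one along
  \<open>a, b, c, d\<close>. Edges of a realization graph are unordered pairs, while
  \<open>two_switch\<close> is directed; this lemma reconciles the two.\<close>

lemma two_switch_sym:
  assumes "two_switch E E'"
  shows "two_switch E' E"
proof -
  from assms obtain a b c d where h: "distinct [a, b, c, d]"
    "{a, b} \<in> E" "{c, d} \<in> E" "{a, d} \<notin> E" "{b, c} \<notin> E"
    "E' = (E - {{a, b}, {c, d}}) \<union> {{a, d}, {b, c}}"
    unfolding two_switch_def by blast
  have ne: "{a, b} \<noteq> {a, d}" "{a, b} \<noteq> {b, c}" "{c, d} \<noteq> {a, d}" "{c, d} \<noteq> {b, c}"
    using h(1) by (auto simp: doubleton_eq_iff)
  have "distinct [a, d, c, b]" using h(1) by auto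
  moreover have "{a, d} \<in> E'" "{c, b} \<in> E'" "{a, b} \<notin> E'" "{d, c} \<notin> E'"
    using h ne by (auto simp: insert_commute)
  moreover have "E = (E' - {{a, d}, {c, b}}) \<union> {{a, b}, {d, c}}"
  proof -
    have "{c, b} = {b, c}" "{d, c} = {c, d}" by auto
    then show ?thesis using h(2-6) ne by auto
  qed
  ultimately show ?thesis unfolding two_switch_def by blast
qed

text \<open>The four pairs involved lie inside \<open>X\<close>, and no nonempty member of
  \<open>K\<close> does, so adding \<open>K\<close> changes the status of none of them. This lifts a
  switch in one part to the whole graph.\<close>

lemma two_switch_extend:
  assumes sw: "two_switch E E'" and E: "E \<subseteq> Pow X"
    and K: "\<And>e. e \<in> K \<Longrightarrow> e \<subseteq> X \<Longrightarrow> e = {}"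
  shows "two_switch (E \<union> K) (E' \<union> K)"
proof -
  from sw obtain a b c d where h: "distinct [a, b, c, d]"
    "{a, b} \<in> E" "{c, d} \<in> E" "{a, d} \<notin> E" "{b, c} \<notin> E"
    "E' = (E - {{a, b}, {c, d}}) \<union> {{a, d}, {b, c}}"
    unfolding two_switch_def by blast
  have "a \<in> X" "b \<in> X" "c \<in> X" "d \<in> X" using h E by auto
  then have "{a, b} \<notin> K" "{c, d} \<notin> K" "{a, d} \<notin> K" "{b, c} \<notin> K" using K by auto
  then have "E' \<union> K = (E \<union> K - {{a, b}, {c, d}}) \<union> {{a, d}, {b, c}}" using h(6) by auto
  then show ?thesis
    unfolding two_switch_def using h(1-5) \<open>{a, d} \<notin> K\<close> \<open>{b, c} \<notin> K\<close> by blast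
qed

lemma fst_realization_graph_on [simp]: "fst (realization_graph_on V f) = realizations_on V f"
  by (simp add: realization_graph_on_def)

lemma edge_realization_graph_on_iff:
  "{E, E'} \<in> snd (realization_graph_on V f) \<longleftrightarrow>
     E \<in> realizations_on V f \<and> E' \<in> realizations_on V f \<and> two_switch E E'"
  by (auto simp: realization_graph_on_def doubleton_eq_iff intro: two_switch_sym)

lemma realizations_on_subset_Pow: "E \<in> realizations_on V f \<Longrightarrow> E \<subseteq> Pow V"
  by (auto simp: realizations_on_def simple_graph_def)

section \<open>Relabelling of vertices\<close>

lemma realizations_on_image:
  assumes bij: "bij_betw \<phi> V V'" and f: "\<And>v. v \<in> V \<Longrightarrow> f' (\<phi> v) = f v"
    and E: "E \<in> realizations_on V f"
  shows "(`) \<phi> ` E \<in> realizations_on V' f'"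
proof -
  have inj: "inj_on \<phi> V" and im: "\<phi> ` V = V'" using bij by (auto simp: bij_betw_def)
  have fin: "finite V" and sub: "\<And>e. e \<in> E \<Longrightarrow> e \<subseteq> V \<and> card e = 2"
    using E by (auto simp: realizations_on_def simple_graph_def)
  have "simple_graph (V', (`) \<phi> ` E)"
    using fin sub im inj by (auto simp: simple_graph_def card_image inj_on_subset)
  moreover have "degree (V', (`) \<phi> ` E) (\<phi> v) = f v" if v: "v \<in> V" for v
  proof -
    have "{e \<in> (`) \<phi> ` E. \<phi> v \<in> e} = (`) \<phi> ` {e \<in> E. v \<in> e}"
    proof -
      have "\<phi> v \<in> \<phi> ` e \<longleftrightarrow> v \<in> e" if "e \<in> E" for e
        using inj_on_image_mem_iff[OF inj v] sub[OF that] by blast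
      then show ?thesis by blast
    qed
    moreover have "inj_on ((`) \<phi>) {e \<in> E. v \<in> e}"
      using inj sub by (auto intro!: inj_onI simp: inj_on_image_eq_iff)
    ultimately have "degree (V', (`) \<phi> ` E) (\<phi> v) = degree (V, E) v"
      by (simp add: degree_def card_image)
    then show ?thesis using E v by (simp add: realizations_on_def)
  qed
  ultimately show ?thesis using im f by (auto simp: realizations_on_def)
qed

lemma two_switch_image:
  assumes inj: "inj_on \<phi> V" and E: "E \<subseteq> Pow V" and sw: "two_switch E E'"
  shows "two_switch ((`) \<phi> ` E) ((`) \<phi> ` E')"
proof -
  from sw obtain a b c d where h: "distinct [a, b, c, d]"
    "{a, b} \<in> E" "{c, d} \<in> E" "{a, d} \<notin> E" "{b, c} \<notin> E"
    "E' = (E - {{a, b}, {c, d}}) \<union> {{a, d}, {b, c}}"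
    unfolding two_switch_def by blast
  have V: "a \<in> V" "b \<in> V" "c \<in> V" "d \<in> V" using h E by auto
  \<comment> \<open>Injectivity on all of \<open>Pow V\<close> is what carries non-edges to
    non-edges, as the switch conditions require.\<close>
  have injP: "inj_on ((`) \<phi>) (Pow V)" using inj by (simp add: inj_on_image_Pow)
  have mem: "\<phi> ` e \<in> (`) \<phi> ` E \<longleftrightarrow> e \<in> E" if "e \<subseteq> V" for e
    using inj_on_image_mem_iff[OF injP, of e E] that E by auto
  have "distinct [\<phi> a, \<phi> b, \<phi> c, \<phi> d]"
    using h(1) V inj by (auto dest: inj_onD)
  moreover have "{\<phi> a, \<phi> b} \<in> (`) \<phi> ` E" "{\<phi> c, \<phi> d} \<in> (`) \<phi> ` E"
    "{\<phi> a, \<phi> d} \<notin> (`) \<phi> ` E" "{\<phi> b, \<phi> c} \<notin> (`) \<phi> ` E"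
    using mem[of "{a, b}"] mem[of "{c, d}"] mem[of "{a, d}"] mem[of "{b, c}"] h V by auto
  moreover have "(`) \<phi> ` E' = ((`) \<phi> ` E - {{\<phi> a, \<phi> b}, {\<phi> c, \<phi> d}}) \<union> {{\<phi> a, \<phi> d}, {\<phi> b, \<phi> c}}"
  proof -
    have "(`) \<phi> ` (E - {{a, b}, {c, d}}) = (`) \<phi> ` E - (`) \<phi> ` {{a, b}, {c, d}}"
      by (rule inj_on_image_set_diff[OF injP]) (use E h in auto)
    then show ?thesis unfolding h(6) by (simp add: image_Un)
  qed
  ultimately show ?thesis unfolding two_switch_def by blast
qed

text \<open>A relabelling acts on edge sets by a double image. The inverse relabelling supplies both
  the inverse of this map and the reflection of switches.\<close>

lemma realization_graph_on_relabel:
  assumes bij: "bij_betw \<phi> V V'" and f: "\<And>v. v \<in> V \<Longrightarrow> f' (\<phi> v) = f v"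
  shows "realization_graph_on V f \<cong>\<^sub>G realization_graph_on V' f'"
proof -
  define \<psi> where "\<psi> = inv_into V \<phi>"
  have bij': "bij_betw \<psi> V' V" unfolding \<psi>_def by (rule bij_betw_inv_into[OF bij])
  have \<psi>\<phi>: "\<psi> (\<phi> v) = v" if "v \<in> V" for v
    unfolding \<psi>_def using bij that by (simp add: bij_betw_inv_into_left)
  have \<phi>\<psi>: "\<phi> (\<psi> v) = v" if "v \<in> V'" for v
    unfolding \<psi>_def using bij that by (simp add: bij_betw_inv_into_right)
  have f': "f (\<psi> v) = f' v" if "v \<in> V'" for v
    using f[of "\<psi> v"] \<phi>\<psi>[OF that] bij' that by (auto dest: bij_betwE)
  have inv1: "(`) \<psi> ` (`) \<phi> ` E = E" if "E \<subseteq> Pow V" for E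
  proof -
    have "\<psi> ` \<phi> ` e = e" if "e \<in> E" for e
      using \<open>E \<subseteq> Pow V\<close> that \<psi>\<phi> by (force simp: image_image)
    then show ?thesis by (force simp: image_image)
  qed
  have inv2: "(`) \<phi> ` (`) \<psi> ` E = E" if "E \<subseteq> Pow V'" for E
  proof -
    have "\<phi> ` \<psi> ` e = e" if "e \<in> E" for e
      using \<open>E \<subseteq> Pow V'\<close> that \<phi>\<psi> by (force simp: image_image)
    then show ?thesis by (force simp: image_image)
  qed
  note im = realizations_on_image[OF bij, of f' f, OF f]
  note im' = realizations_on_image[OF bij', of f f', OF f']
  have "bij_betw ((`) ((`) \<phi>)) (realizations_on V f) (realizations_on V' f')"
  proof (rule bij_betw_byWitness[where f' = "(`) ((`) \<psi>)"])
    show "\<forall>E \<in> realizations_on V f. (`) \<psi> ` (`) \<phi> ` E = E"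
      by (intro ballI inv1 realizations_on_subset_Pow)
    show "\<forall>E \<in> realizations_on V' f'. (`) \<phi> ` (`) \<psi> ` E = E"
      by (intro ballI inv2 realizations_on_subset_Pow)
    show "(`) ((`) \<phi>) ` realizations_on V f \<subseteq> realizations_on V' f'" by (intro image_subsetI im)
    show "(`) ((`) \<psi>) ` realizations_on V' f' \<subseteq> realizations_on V f" by (intro image_subsetI im')
  qed
  moreover have "two_switch E E' \<longleftrightarrow> two_switch ((`) \<phi> ` E) ((`) \<phi> ` E')"
    if "E \<in> realizations_on V f" "E' \<in> realizations_on V f" for E E'
  proof
    have "E \<subseteq> Pow V" "E' \<subseteq> Pow V" "(`) \<phi> ` E \<subseteq> Pow V'"
      using that im[of E] by (auto dest!: realizations_on_subset_Pow)
    note s = this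
    show "two_switch ((`) \<phi> ` E) ((`) \<phi> ` E')" if "two_switch E E'"
      using two_switch_image[OF bij_betw_imp_inj_on[OF bij] s(1) that] .
    show "two_switch E E'" if "two_switch ((`) \<phi> ` E) ((`) \<phi> ` E')"
      using two_switch_image[OF bij_betw_imp_inj_on[OF bij'] s(3) that] inv1 s by simp
  qed
  ultimately show ?thesis
    unfolding graph_iso_def fst_realization_graph_on edge_realization_graph_on_iff
    by (intro exI[of _ "(`) ((`) \<phi>)"]) (simp add: im)
qed

text \<open>Lists with equal multisets differ by a bijection of positions, which is a relabelling.
  Hence the sorting in \<open>comp_seq\<close> and \<open>splitted_terms\<close> is
  harmless.\<close>

lemma realization_graph_mset_cong:
  assumes "mset xs = mset ys"
  shows "realization_graph xs \<cong>\<^sub>G realization_graph ys"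
proof -
  obtain \<phi> where "bij_betw \<phi> {..<length xs} {..<length ys}" "\<forall>i<length xs. xs ! i = ys ! \<phi> i"
    using permutation_Ex_bij[OF assms] by blast
  then show ?thesis
    unfolding realization_graph_eq by (intro realization_graph_on_relabel) auto
qed

lemma mset_sort_desc [simp]: "mset (sort_desc xs) = mset xs"
  by (simp add: sort_desc_def)

section \<open>Isomorphisms and binary Cartesian products\<close>

lemma graph_iso_refl: "G \<cong>\<^sub>G G"
  unfolding graph_iso_def by (intro exI[of _ id]) simp

lemma graph_iso_trans:
  assumes "G \<cong>\<^sub>G H" "H \<cong>\<^sub>G K"
  shows "G \<cong>\<^sub>G K"
proof -
  from assms obtain f g where f: "bij_betw f (fst G) (fst H)"
      "\<And>u v. u \<in> fst G \<Longrightarrow> v \<in> fst G \<Longrightarrow> {u, v} \<in> snd G \<longleftrightarrow> {f u, f v} \<in> snd H"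
    and g: "bij_betw g (fst H) (fst K)"
      "\<And>u v. u \<in> fst H \<Longrightarrow> v \<in> fst H \<Longrightarrow> {u, v} \<in> snd H \<longleftrightarrow> {g u, g v} \<in> snd K"
    unfolding graph_iso_def by blast
  have "bij_betw (g \<circ> f) (fst G) (fst K)" using f(1) g(1) by (rule bij_betw_trans)
  moreover have "{u, v} \<in> snd G \<longleftrightarrow> {(g \<circ> f) u, (g \<circ> f) v} \<in> snd K"
    if "u \<in> fst G" "v \<in> fst G" for u v
    using f g(2)[of "f u" "f v"] that by (simp add: bij_betw_apply)
  ultimately show ?thesis unfolding graph_iso_def by blast
qed

lemma graph_iso_sym:
  assumes "G \<cong>\<^sub>G H"
  shows "H \<cong>\<^sub>G G"
proof -
  from assms obtain f where f: "bij_betw f (fst G) (fst H)"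
      "\<And>u v. u \<in> fst G \<Longrightarrow> v \<in> fst G \<Longrightarrow> {u, v} \<in> snd G \<longleftrightarrow> {f u, f v} \<in> snd H"
    unfolding graph_iso_def by blast
  let ?g = "inv_into (fst G) f"
  have g: "bij_betw ?g (fst H) (fst G)" using f(1) by (rule bij_betw_inv_into)
  moreover have "{u, v} \<in> snd H \<longleftrightarrow> {?g u, ?g v} \<in> snd G"
    if "u \<in> fst H" "v \<in> fst H" for u v
    using f(2)[of "?g u" "?g v"] that g bij_betw_inv_into_right[OF f(1)]
    by (simp add: bij_betw_apply)
  ultimately show ?thesis unfolding graph_iso_def by blast
qed

text \<open>A product of pairs allows factors of different vertex types, so that one realization
  graph can be multiplied by a product of several whose vertices are lists.\<close>

definition cart_prod2 :: "'a sgraph \<Rightarrow> 'b sgraph \<Rightarrow> ('a \<times> 'b) sgraph" where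
  "cart_prod2 G H = (fst G \<times> fst H,
     {{(x, y), (x', y')} | x y x' y'. x \<in> fst G \<and> x' \<in> fst G \<and> y \<in> fst H \<and> y' \<in> fst H \<and>
        (x = x' \<and> {y, y'} \<in> snd H \<or> y = y' \<and> {x, x'} \<in> snd G)})"

lemma fst_cart_prod2 [simp]: "fst (cart_prod2 G H) = fst G \<times> fst H"
  by (simp add: cart_prod2_def)

lemma edge_cart_prod2_iff:
  "{(x, y), (x', y')} \<in> snd (cart_prod2 G H) \<longleftrightarrow>
     x \<in> fst G \<and> x' \<in> fst G \<and> y \<in> fst H \<and> y' \<in> fst H \<and>
     (x = x' \<and> {y, y'} \<in> snd H \<or> y = y' \<and> {x, x'} \<in> snd G)"
  unfolding cart_prod2_def by (auto simp: doubleton_eq_iff insert_commute)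

lemma cart_prod2_cong:
  assumes "G \<cong>\<^sub>G G'" "H \<cong>\<^sub>G H'"
  shows "cart_prod2 G H \<cong>\<^sub>G cart_prod2 G' H'"
proof -
  from assms obtain f g where f: "bij_betw f (fst G) (fst G')"
      "\<And>u v. u \<in> fst G \<Longrightarrow> v \<in> fst G \<Longrightarrow> {u, v} \<in> snd G \<longleftrightarrow> {f u, f v} \<in> snd G'"
    and g: "bij_betw g (fst H) (fst H')"
      "\<And>u v. u \<in> fst H \<Longrightarrow> v \<in> fst H \<Longrightarrow> {u, v} \<in> snd H \<longleftrightarrow> {g u, g v} \<in> snd H'"
    unfolding graph_iso_def by blast
  have "bij_betw (map_prod f g) (fst G \<times> fst H) (fst G' \<times> fst H')"
    using f(1) g(1) by (rule bij_betw_map_prod)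
  moreover have "{(x, y), (x', y')} \<in> snd (cart_prod2 G H) \<longleftrightarrow>
      {(f x, g y), (f x', g y')} \<in> snd (cart_prod2 G' H')"
    if m: "x \<in> fst G" "y \<in> fst H" "x' \<in> fst G" "y' \<in> fst H" for x y x' y'
  proof -
    have "f x = f x' \<longleftrightarrow> x = x'" "g y = g y' \<longleftrightarrow> y = y'"
      using f(1) g(1) m by (auto simp: bij_betw_def inj_on_eq_iff)
    then show ?thesis
      unfolding edge_cart_prod2_iff using m f g by (simp add: bij_betw_apply)
  qed
  ultimately show ?thesis
    unfolding graph_iso_def by (intro exI[of _ "map_prod f g"]) auto
qed

lemma fst_cart_prod [simp]: "fst (cart_prod Gs) = listset (map fst Gs)"
  by (simp add: cart_prod_def)

lemma edge_cart_prod_iff: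
  "{xs, ys} \<in> snd (cart_prod Gs) \<longleftrightarrow>
     xs \<in> listset (map fst Gs) \<and> ys \<in> listset (map fst Gs) \<and>
     (\<exists>i < length Gs. {xs ! i, ys ! i} \<in> snd (Gs ! i) \<and>
        (\<forall>j < length Gs. j \<noteq> i \<longrightarrow> xs ! j = ys ! j))" (is "?L \<longleftrightarrow> ?P xs ys")
proof -
  \<comment> \<open>The doubleton may be represented in either order; symmetry of the adjacency
    condition identifies the two readings.\<close>
  have "?P ys xs \<Longrightarrow> ?P xs ys" by (auto simp: insert_commute)
  moreover have "?L \<longleftrightarrow> ?P xs ys \<or> ?P ys xs"
    unfolding cart_prod_def snd_conv mem_Collect_eq doubleton_eq_iff by blast
  ultimately show ?thesis by blast
qed

lemma length_listset: "xs \<in> listset As \<Longrightarrow> length xs = length As"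
  by (induction As arbitrary: xs) (auto simp: set_Cons_def)

lemma cart_prod_Cons_iso:
  "cart_prod2 G (cart_prod Gs) \<cong>\<^sub>G cart_prod (G # Gs)"
proof -
  let ?f = "\<lambda>(x, xs). x # xs"
  have "bij_betw ?f (fst G \<times> listset (map fst Gs)) (listset (map fst (G # Gs)))"
    by (auto simp: bij_betw_def inj_on_def set_Cons_def image_iff)
  moreover have "{(x, xs), (y, ys)} \<in> snd (cart_prod2 G (cart_prod Gs)) \<longleftrightarrow>
      {x # xs, y # ys} \<in> snd (cart_prod (G # Gs))"
    if m: "x \<in> fst G" "y \<in> fst G" "xs \<in> listset (map fst Gs)" "ys \<in> listset (map fst Gs)"
    for x y xs ys
  proof -
    \<comment> \<open>Splitting the index of the changing coordinate into 0 and successors yields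
      the two cases of \<open>cart_prod2\<close>; in the case 0 the tails agree in every coordinate
      and are equal, having the same length.\<close>
    have "xs = ys \<longleftrightarrow> (\<forall>j < length Gs. xs ! j = ys ! j)"
      using m(3,4) by (auto dest!: length_listset intro: nth_equalityI)
    then show ?thesis
      unfolding edge_cart_prod2_iff edge_cart_prod_iff fst_cart_prod
      using m by (auto simp: set_Cons_def Ex_less_Suc2 All_less_Suc2)
  qed
  ultimately show ?thesis
    unfolding graph_iso_def by (intro exI[of _ ?f]) auto
qed

lemma cart_prod_single_iso: "G \<cong>\<^sub>G cart_prod [G]"
proof -
  have "bij_betw (\<lambda>x. [x]) (fst G) (listset [fst G])"
    by (auto simp: bij_betw_def inj_on_def set_Cons_def)
  then show ?thesis
    unfolding graph_iso_def edge_cart_prod_iff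
    by (intro exI[of _ "\<lambda>x. [x]"]) (auto simp: set_Cons_def)
qed

section \<open>Realizations of a composition\<close>

lemma degree_eq_sum:
  assumes "simple_graph (V, E)" "v \<in> V"
  shows "degree (V, E) v = (\<Sum>u \<in> V. of_bool ({v, u} \<in> E))"
proof -
  have fin: "finite V" and sub: "\<And>e. e \<in> E \<Longrightarrow> e \<subseteq> V \<and> card e = 2"
    using assms by (auto simp: simple_graph_def)
  have "{e \<in> E. v \<in> e} = (\<lambda>u. {v, u}) ` {u \<in> V. {v, u} \<in> E}"
  proof (intro equalityI subsetI)
    fix e assume e: "e \<in> {e \<in> E. v \<in> e}"
    then obtain x y where "e = {x, y}" using sub by (metis (no_types, lifting) card_2_iff mem_Collect_eq)
    with e obtain u where "e = {v, u}" by auto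
    then show "e \<in> (\<lambda>u. {v, u}) ` {u \<in> V. {v, u} \<in> E}" using e sub by auto
  qed auto
  moreover have "inj_on (\<lambda>u. {v, u}) {u \<in> V. {v, u} \<in> E}"
    by (auto simp: inj_on_def doubleton_eq_iff)
  ultimately have "degree (V, E) v = card {u \<in> V. {v, u} \<in> E}"
    by (simp add: degree_def card_image)
  also have "\<dots> = (\<Sum>u \<in> V. of_bool ({v, u} \<in> E))"
    using fin by (simp add: Int_def)
  finally show ?thesis .
qed

lemma simple_graph_no_loop: "simple_graph (V, E) \<Longrightarrow> {v} \<notin> E"
  by (auto simp: simple_graph_def)

text \<open>Ordered pairs are counted, so in a simple graph \<open>edge_count E X X\<close> is twice
  the number of edges inside \<open>X\<close>, which is what a degree sum over \<open>X\<close>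
  collects.\<close>

definition edge_count :: "'a set set \<Rightarrow> 'a set \<Rightarrow> 'a set \<Rightarrow> nat" where
  "edge_count E X Y = (\<Sum>x \<in> X. \<Sum>y \<in> Y. of_bool ({x, y} \<in> E))"

lemma edge_count_commute: "edge_count E X Y = edge_count E Y X"
  unfolding edge_count_def by (subst sum.swap) (simp add: insert_commute)

lemma edge_count_Un_right:
  assumes "finite Y" "finite Z" "Y \<inter> Z = {}"
  shows "edge_count E X (Y \<union> Z) = edge_count E X Y + edge_count E X Z"
  using assms by (simp add: edge_count_def sum.union_disjoint sum.distrib del: sum_of_bool_eq)

lemma sum_degree_eq_edge_count:
  assumes "simple_graph (V, E)" "X \<subseteq> V"
  shows "(\<Sum>x \<in> X. degree (V, E) x) = edge_count E X V"
  unfolding edge_count_def using assms by (intro sum.cong degree_eq_sum) auto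

lemma edge_count_le: "edge_count E X Y \<le> card X * card Y"
proof -
  have "edge_count E X Y \<le> (\<Sum>x \<in> X. \<Sum>y \<in> Y. 1)"
    unfolding edge_count_def by (intro sum_mono) auto
  then show ?thesis by simp
qed

text \<open>Every indicator is at most 1, so equality of the totals forces equality of each inner
  sum and then of each term.\<close>

lemma edge_count_eq_max:
  assumes "finite X" "finite Y" "edge_count E X Y = card X * card Y" "x \<in> X" "y \<in> Y"
  shows "{x, y} \<in> E"
proof -
  have "(\<Sum>x \<in> X. \<Sum>y \<in> Y. of_bool ({x, y} \<in> E)) = (\<Sum>x \<in> X. \<Sum>y \<in> Y. 1 :: nat)"
    using assms(3) by (simp add: edge_count_def)
  then have "(\<Sum>y \<in> Y. of_bool ({x, y} \<in> E)) = (\<Sum>y \<in> Y. 1 :: nat)"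
    by (rule sum_mono_inv) (use assms in \<open>auto intro!: sum_mono simp del: sum_of_bool_eq sum_constant\<close>)
  then have "of_bool ({x, y} \<in> E) = (1 :: nat)"
    by (rule sum_mono_inv) (use assms in auto)
  then show ?thesis by (simp split: if_splits add: of_bool_def)
qed

lemma edge_count_eq_0:
  assumes "finite X" "finite Y" "edge_count E X Y = 0" "x \<in> X" "y \<in> Y"
  shows "{x, y} \<notin> E"
  using assms by (auto simp: edge_count_def simp del: sum_of_bool_eq)

lemma sum_of_bool_neq:
  assumes "finite X" "x \<in> X"
  shows "(\<Sum>y \<in> X. of_bool (x \<noteq> y)) = card X - 1"
proof -
  have "X \<inter> {y. x \<noteq> y} = X - {x}" by auto
  then show ?thesis using assms by simp
qed

text \<open>A simple graph has no singleton edges, so the diagonal pairs drop out. For empty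
  \<open>X\<close> the truncated \<open>card X - 1\<close> does no harm, since the product is
  0.\<close>

lemma edge_count_self_le:
  assumes "simple_graph (V, E)" "finite X"
  shows "edge_count E X X \<le> card X * (card X - 1)"
proof -
  have "edge_count E X X \<le> (\<Sum>x \<in> X. \<Sum>y \<in> X. of_bool (x \<noteq> y))"
    unfolding edge_count_def using simple_graph_no_loop[OF assms(1)] by (intro sum_mono) auto
  also have "\<dots> = (\<Sum>x \<in> X. card X - 1)"
    by (intro sum.cong refl sum_of_bool_neq assms(2))
  finally show ?thesis by simp
qed

lemma edge_count_clique:
  assumes "simple_graph (V, E)" "finite X"
    and "\<And>x y. x \<in> X \<Longrightarrow> y \<in> X \<Longrightarrow> x \<noteq> y \<Longrightarrow> {x, y} \<in> E"
  shows "edge_count E X X = card X * (card X - 1)"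
proof -
  have "edge_count E X X = (\<Sum>x \<in> X. \<Sum>y \<in> X. of_bool (x \<noteq> y))"
    unfolding edge_count_def using simple_graph_no_loop[OF assms(1)] assms(3)
    by (intro sum.cong refl arg_cong[where f = of_bool]) auto
  also have "\<dots> = (\<Sum>x \<in> X. card X - 1)"
    by (intro sum.cong refl sum_of_bool_neq assms(2))
  finally show ?thesis by simp
qed

text \<open>The edges between \<open>A\<close> and \<open>B\<close> occur in both degree sums and
  cancel; the clique \<open>A\<close> leaves its full count, the independent set \<open>B\<close>
  leaves 0.\<close>

lemma split_degree_sums:
  assumes E: "E \<in> realizations_on (A \<union> B) g" and disj: "A \<inter> B = {}"
    and clique: "\<And>x y. x \<in> A \<Longrightarrow> y \<in> A \<Longrightarrow> x \<noteq> y \<Longrightarrow> {x, y} \<in> E"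
    and indep: "\<And>x y. x \<in> B \<Longrightarrow> y \<in> B \<Longrightarrow> {x, y} \<notin> E"
  shows "sum g A = sum g B + card A * (card A - 1)"
proof -
  have G: "simple_graph (A \<union> B, E)" and deg: "\<And>v. v \<in> A \<union> B \<Longrightarrow> degree (A \<union> B, E) v = g v"
    using E by (auto simp: realizations_on_def)
  then have fin: "finite A" "finite B" by (auto simp: simple_graph_def)
  have "sum g A = edge_count E A A + edge_count E A B"
    using sum_degree_eq_edge_count[OF G, of A] deg edge_count_Un_right[OF fin disj, of E A] by simp
  moreover have "sum g B = edge_count E B A + edge_count E B B"
    using sum_degree_eq_edge_count[OF G, of B] deg edge_count_Un_right[OF fin disj, of E B] by simp
  moreover have "edge_count E B B = 0" using indep by (simp add: edge_count_def)
  moreover have "edge_count E A A = card A * (card A - 1)"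
    using edge_count_clique[OF G fin(1) clique] .
  ultimately show ?thesis using edge_count_commute[of E A B] by simp
qed

section \<open>Realizations of a composition split into two independent parts\<close>

text \<open>\<open>A\<close> and \<open>B\<close> are the clique and independent sides of the
  splitted sequence, with degrees \<open>g\<close>; \<open>Q\<close> carries the other sequence,
  with degrees \<open>h\<close>. Splitness enters through the numerical identity
  \<open>sums\<close>, which depends on degrees alone and therefore constrains every realization at
  once.\<close>

locale composition =
  fixes A B Q :: "'a set" and f g h :: "'a \<Rightarrow> nat"
  assumes fin: "finite A" "finite B" "finite Q"
    and disj: "A \<inter> B = {}" "A \<inter> Q = {}" "B \<inter> Q = {}"
    and f_A: "\<And>v. v \<in> A \<Longrightarrow> f v = g v + card Q"
    and f_B: "\<And>v. v \<in> B \<Longrightarrow> f v = g v"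
    and f_Q: "\<And>v. v \<in> Q \<Longrightarrow> f v = h v + card A"
    and sums: "sum g A = sum g B + card A * (card A - 1)"
begin

abbreviation "P \<equiv> A \<union> B"

text \<open>By \<open>cross_pairs\<close>, these are exactly the edges between \<open>P\<close> and
  \<open>Q\<close> in every realization of \<open>f\<close>.\<close>

definition joins :: "'a set set" where
  "joins = {{a, q} | a q. a \<in> A \<and> q \<in> Q}"

lemma cross_pairs:
  assumes E: "E \<in> realizations_on (P \<union> Q) f" and q: "q \<in> Q"
  shows "a \<in> A \<Longrightarrow> {a, q} \<in> E" and "b \<in> B \<Longrightarrow> {b, q} \<notin> E"
proof -
  have G: "simple_graph (P \<union> Q, E)" and deg: "\<And>v. v \<in> P \<union> Q \<Longrightarrow> degree (P \<union> Q, E) v = f v"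
    using E by (auto simp: realizations_on_def)
  have un: "edge_count E X (P \<union> Q) = edge_count E X A + edge_count E X B + edge_count E X Q" for X
  proof -
    have "P \<inter> Q = {}" using disj by blast
    then show ?thesis using fin disj by (simp add: edge_count_Un_right)
  qed
  have "sum f A = edge_count E A A + edge_count E A B + edge_count E A Q"
    using sum_degree_eq_edge_count[OF G, of A] deg un[of A] by auto
  moreover have "sum f A = sum g A + card A * card Q" using f_A by (simp add: sum.distrib)
  moreover have "sum g B = edge_count E B A + edge_count E B B + edge_count E B Q"
    using sum_degree_eq_edge_count[OF G, of B] deg un[of B] f_B by auto
  moreover note sums edge_count_commute[of E A B] edge_count_self_le[OF G fin(1)]
    edge_count_le[of E A Q]
  \<comment> \<open>Write e for \<open>edge_count E\<close>. Cancelling e(A,B) leaves e(A,A) +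
    e(A,Q) = |A|(|A|-1) + |A||Q| + e(B,B) + e(B,Q). Each term on the left is bounded by its
    counterpart on the right, so e(A,Q) is maximal and e(B,Q) vanishes.\<close>
  ultimately have "edge_count E A Q = card A * card Q" "edge_count E B Q = 0" by linarith+
  then show "a \<in> A \<Longrightarrow> {a, q} \<in> E" "b \<in> B \<Longrightarrow> {b, q} \<notin> E"
    using edge_count_eq_max edge_count_eq_0 fin q by metis+
qed

lemma decompose:
  assumes E: "E \<in> realizations_on (P \<union> Q) f"
  shows "E = (E \<inter> Pow P) \<union> (E \<inter> Pow Q) \<union> joins"
proof
  show "(E \<inter> Pow P) \<union> (E \<inter> Pow Q) \<union> joins \<subseteq> E"
    using cross_pairs(1)[OF E] by (auto simp: joins_def)
  show "E \<subseteq> (E \<inter> Pow P) \<union> (E \<inter> Pow Q) \<union> joins"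
  proof
    fix e assume e: "e \<in> E"
    then have "e \<subseteq> P \<union> Q" "card e = 2" using E by (auto simp: realizations_on_def simple_graph_def)
    then obtain x y where xy: "e = {x, y}" "x \<in> P \<union> Q" "y \<in> P \<union> Q" by (auto simp: card_2_iff)
    then show "e \<in> (E \<inter> Pow P) \<union> (E \<inter> Pow Q) \<union> joins"
      using e cross_pairs(2)[OF E, of y x] cross_pairs(2)[OF E, of x y]
      by (auto simp: joins_def insert_commute)
  qed
qed

lemma joins_disjoint: "e \<subseteq> P \<Longrightarrow> e \<notin> joins" "e \<subseteq> Q \<Longrightarrow> e \<notin> joins"
  using disj by (auto simp: joins_def)

lemma simple_graph_union_iff:
  assumes "E1 \<subseteq> Pow P" "E2 \<subseteq> Pow Q"
  shows "simple_graph (P \<union> Q, E1 \<union> E2 \<union> joins) \<longleftrightarrow> simple_graph (P, E1) \<and> simple_graph (Q, E2)"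
proof -
  have "card e = 2 \<and> e \<subseteq> P \<union> Q" if "e \<in> joins" for e
  proof -
    from that obtain a q where "e = {a, q}" "a \<in> A" "q \<in> Q" by (auto simp: joins_def)
    moreover from this have "a \<noteq> q" using disj by auto
    ultimately show ?thesis by auto
  qed
  then show ?thesis using assms fin by (auto simp: simple_graph_def)
qed

text \<open>These three counts are the shifts by which \<open>f\<close> exceeds \<open>g\<close> on
  \<open>A\<close> and \<open>B\<close> and \<open>h\<close> on \<open>Q\<close>.\<close>

lemma card_joins:
  "v \<in> A \<Longrightarrow> card {e \<in> joins. v \<in> e} = card Q"
  "v \<in> B \<Longrightarrow> card {e \<in> joins. v \<in> e} = 0"
  "v \<in> Q \<Longrightarrow> card {e \<in> joins. v \<in> e} = card A"
proof -
  show "card {e \<in> joins. v \<in> e} = card Q" if "v \<in> A"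
  proof -
    have "{e \<in> joins. v \<in> e} = (\<lambda>q. {v, q}) ` Q" using that disj by (auto simp: joins_def)
    then show ?thesis by (simp add: card_image inj_on_def doubleton_eq_iff)
  qed
  show "card {e \<in> joins. v \<in> e} = card A" if "v \<in> Q"
  proof -
    have "{e \<in> joins. v \<in> e} = (\<lambda>a. {a, v}) ` A" using that disj by (auto simp: joins_def)
    then show ?thesis by (simp add: card_image inj_on_def doubleton_eq_iff)
  qed
  show "card {e \<in> joins. v \<in> e} = 0" if "v \<in> B"
  proof -
    have "{e \<in> joins. v \<in> e} = {}" using that disj by (auto simp: joins_def)
    then show ?thesis by (simp only: card.empty)
  qed
qed

lemma degree_union:
  assumes E: "E1 \<subseteq> Pow P" "E2 \<subseteq> Pow Q"
  shows "degree (V, E1 \<union> E2 \<union> joins) v =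
    card {e \<in> E1. v \<in> e} + card {e \<in> E2. v \<in> e} + card {e \<in> joins. v \<in> e}"
proof -
  have "joins \<subseteq> Pow (P \<union> Q)" by (auto simp: joins_def)
  then have finE: "finite E1" "finite E2" "finite joins"
    using E fin by (meson finite_Pow_iff finite_UnI finite_subset)+
  \<comment> \<open>Disjointness is claimed for the members through \<open>v\<close> only, since the
    hypotheses allow the empty set in both \<open>E1\<close> and \<open>E2\<close>.\<close>
  have d1: "{e \<in> E1. v \<in> e} \<inter> {e \<in> E2. v \<in> e} = {}" using E disj by blast
  have "e \<notin> joins" if "e \<in> E1 \<union> E2" for e using that E joins_disjoint[of e] by auto
  then have d2: "({e \<in> E1. v \<in> e} \<union> {e \<in> E2. v \<in> e}) \<inter> {e \<in> joins. v \<in> e} = {}"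
    by blast
  have "{e \<in> E1 \<union> E2 \<union> joins. v \<in> e} =
      ({e \<in> E1. v \<in> e} \<union> {e \<in> E2. v \<in> e}) \<union> {e \<in> joins. v \<in> e}" by auto
  then show ?thesis using finE d1 d2 by (simp add: degree_def card_Un_disjoint)
qed

text \<open>At a vertex of one part the other part contributes nothing, and \<open>joins\<close>
  contributes exactly the shift in \<open>f\<close>. So any two realizations of the parts can be
  glued, and only those.\<close>

lemma union_realization_iff:
  assumes E: "E1 \<subseteq> Pow P" "E2 \<subseteq> Pow Q"
  shows "E1 \<union> E2 \<union> joins \<in> realizations_on (P \<union> Q) f \<longleftrightarrow>
    E1 \<in> realizations_on P g \<and> E2 \<in> realizations_on Q h"
proof -
  have E1: "card {e \<in> E2. v \<in> e} = 0" if "v \<in> P" for v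
  proof -
    have "{e \<in> E2. v \<in> e} = {}" using E that disj by blast
    then show ?thesis by (simp only: card.empty)
  qed
  have E2: "card {e \<in> E1. v \<in> e} = 0" if "v \<in> Q" for v
  proof -
    have "{e \<in> E1. v \<in> e} = {}" using E that disj by blast
    then show ?thesis by (simp only: card.empty)
  qed
  have "degree (P \<union> Q, E1 \<union> E2 \<union> joins) v = f v \<longleftrightarrow> degree (P, E1) v = g v" if "v \<in> P" for v
    using that E1[OF that] card_joins f_A f_B unfolding degree_union[OF E] by (auto simp: degree_def)
  moreover have "degree (P \<union> Q, E1 \<union> E2 \<union> joins) v = f v \<longleftrightarrow> degree (Q, E2) v = h v" if "v \<in> Q" for v
    using that E2[OF that] card_joins f_Q unfolding degree_union[OF E] by (auto simp: degree_def)
  ultimately show ?thesis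
    unfolding realizations_on_def mem_Collect_eq simple_graph_union_iff[OF E] by blast
qed

lemma union_restrict:
  assumes "E1 \<subseteq> Pow P" "E2 \<subseteq> Pow Q" "{} \<notin> E1" "{} \<notin> E2"
  shows "(E1 \<union> E2 \<union> joins) \<inter> Pow P = E1" "(E1 \<union> E2 \<union> joins) \<inter> Pow Q = E2"
proof -
  have "e = {}" if "e \<subseteq> P" "e \<subseteq> Q" for e using disj that by blast
  then have "e \<notin> Pow Q" if "e \<in> E1" for e using assms that by (metis PowD subsetD)
  moreover have "e \<notin> Pow P" if "e \<in> E2" for e
    using assms that \<open>\<And>e. e \<subseteq> P \<Longrightarrow> e \<subseteq> Q \<Longrightarrow> e = {}\<close> by (metis PowD subsetD)
  ultimately show "(E1 \<union> E2 \<union> joins) \<inter> Pow P = E1" "(E1 \<union> E2 \<union> joins) \<inter> Pow Q = E2"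
    using assms(1,2) joins_disjoint by auto
qed

section \<open>2-switches in a composition and the product structure\<close>

lemma two_switch_restrict:
  assumes E: "E \<in> realizations_on (P \<union> Q) f" and E': "E' \<in> realizations_on (P \<union> Q) f"
    and sw: "two_switch E E'"
  shows "E \<inter> Pow P = E' \<inter> Pow P \<and> two_switch (E \<inter> Pow Q) (E' \<inter> Pow Q) \<or>
    E \<inter> Pow Q = E' \<inter> Pow Q \<and> two_switch (E \<inter> Pow P) (E' \<inter> Pow P)"
proof -
  from sw obtain a b c d where h: "distinct [a, b, c, d]"
    "{a, b} \<in> E" "{c, d} \<in> E" "{a, d} \<notin> E" "{b, c} \<notin> E"
    "E' = (E - {{a, b}, {c, d}}) \<union> {{a, d}, {b, c}}"
    unfolding two_switch_def by blast
  have ne: "{a, b} \<noteq> {a, d}" "{a, b} \<noteq> {b, c}" "{c, d} \<noteq> {a, d}" "{c, d} \<noteq> {b, c}"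
    using h(1) by (auto simp: doubleton_eq_iff)
  have h': "{a, b} \<notin> E'" "{c, d} \<notin> E'" "{a, d} \<in> E'" "{b, c} \<in> E'" using h ne by auto
  have V: "a \<in> P \<union> Q" "b \<in> P \<union> Q" "c \<in> P \<union> Q" "d \<in> P \<union> Q"
    using h(2,3) realizations_on_subset_Pow[OF E] by auto
  have fixed: "{x, y} \<in> E \<longleftrightarrow> {x, y} \<in> E'" if "x \<in> P" "y \<in> Q" for x y
    using cross_pairs[OF E that(2)] cross_pairs[OF E' that(2)] that(1) by blast
  have same: "x \<in> P \<longleftrightarrow> y \<in> P"
    if "{x, y} \<in> E \<longleftrightarrow> {x, y} \<notin> E'" "x \<in> P \<union> Q" "y \<in> P \<union> Q" for x y
    using fixed[of x y] fixed[of y x] that by (auto simp: insert_commute)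
  \<comment> \<open>The pairs \<open>ab\<close>, \<open>ad\<close>, \<open>cd\<close> change status,
    whereas pairs between \<open>P\<close> and \<open>Q\<close> are fixed. These three form a path
    through all four vertices, which therefore lie on one side.\<close>
  have side: "a \<in> P \<longleftrightarrow> b \<in> P" "c \<in> P \<longleftrightarrow> d \<in> P" "a \<in> P \<longleftrightarrow> d \<in> P"
    using same[of a b] same[of c d] same[of a d] h h' V by blast+
  have restrict: "two_switch (E \<inter> Pow X) (E' \<inter> Pow X) \<and> E \<inter> Pow Y = E' \<inter> Pow Y"
    if X: "a \<in> X" "b \<in> X" "c \<in> X" "d \<in> X" and Y: "X \<inter> Y = {}" for X Y
  proof
    have "E' \<inter> Pow X = (E \<inter> Pow X - {{a, b}, {c, d}}) \<union> {{a, d}, {b, c}}"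
      using h(6) X by auto
    then show "two_switch (E \<inter> Pow X) (E' \<inter> Pow X)"
      unfolding two_switch_def using h(1-5) X by blast
    \<comment> \<open>Each of the four switched pairs contains \<open>a\<close> or \<open>c\<close>,
      so none is a subset of \<open>Y\<close>.\<close>
    have "a \<notin> Y" "c \<notin> Y" using X Y by auto
    then show "E \<inter> Pow Y = E' \<inter> Pow Y" using h(6) by auto
  qed
  show ?thesis
  proof (cases "a \<in> P")
    case True
    then have "b \<in> P" "c \<in> P" "d \<in> P" using side by blast+
    moreover have "P \<inter> Q = {}" using disj by blast
    ultimately show ?thesis using restrict[of P Q] True by simp
  next
    case False
    then have "a \<in> Q" "b \<in> Q" "c \<in> Q" "d \<in> Q" using side V by blast+
    moreover have "Q \<inter> P = {}" using disj by blast
    ultimately show ?thesis using restrict[of Q P] by simp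
  qed
qed

text \<open>Gluing along \<open>joins\<close> is inverse to restricting to \<open>P\<close> and
  \<open>Q\<close>. A switch changes exactly one of the two restrictions, and changes it by a
  switch, which is Cartesian adjacency.\<close>

lemma realization_graph_composition:
  "cart_prod2 (realization_graph_on P g) (realization_graph_on Q h) \<cong>\<^sub>G
    realization_graph_on (P \<union> Q) f"
proof -
  let ?R1 = "realizations_on P g" and ?R2 = "realizations_on Q h"
    and ?R = "realizations_on (P \<union> Q) f"
  let ?F = "\<lambda>(E1, E2). E1 \<union> E2 \<union> joins"
  have nonempty: "{} \<notin> E" if "E \<in> realizations_on V k" for E :: "'a set set" and V k
    using that by (auto simp: realizations_on_def simple_graph_def)
  have restr: "(E1 \<union> E2 \<union> joins) \<inter> Pow P = E1" "(E1 \<union> E2 \<union> joins) \<inter> Pow Q = E2"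
    if "E1 \<in> ?R1" "E2 \<in> ?R2" for E1 E2
    using union_restrict that nonempty realizations_on_subset_Pow by metis+
  have mem: "E1 \<union> E2 \<union> joins \<in> ?R" if "E1 \<in> ?R1" "E2 \<in> ?R2" for E1 E2
    using union_realization_iff that realizations_on_subset_Pow by metis
  have "bij_betw ?F (?R1 \<times> ?R2) ?R"
  proof (rule bij_betw_byWitness[where f' = "\<lambda>E. (E \<inter> Pow P, E \<inter> Pow Q)"])
    show "\<forall>p \<in> ?R1 \<times> ?R2. (?F p \<inter> Pow P, ?F p \<inter> Pow Q) = p" using restr by auto
    show "\<forall>E \<in> ?R. ?F (E \<inter> Pow P, E \<inter> Pow Q) = E" using decompose by auto
    show "?F ` (?R1 \<times> ?R2) \<subseteq> ?R" using mem by auto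
    show "(\<lambda>E. (E \<inter> Pow P, E \<inter> Pow Q)) ` ?R \<subseteq> ?R1 \<times> ?R2"
    proof (intro image_subsetI)
      fix E assume "E \<in> ?R"
      then show "(E \<inter> Pow P, E \<inter> Pow Q) \<in> ?R1 \<times> ?R2"
        using decompose[of E] union_realization_iff[of "E \<inter> Pow P" "E \<inter> Pow Q"] by auto
    qed
  qed
  moreover have "E1 = E1' \<and> two_switch E2 E2' \<or> E2 = E2' \<and> two_switch E1 E1' \<longleftrightarrow>
      two_switch (E1 \<union> E2 \<union> joins) (E1' \<union> E2' \<union> joins)" (is "?L \<longleftrightarrow> ?S")
    if m: "E1 \<in> ?R1" "E2 \<in> ?R2" "E1' \<in> ?R1" "E2' \<in> ?R2" for E1 E2 E1' E2'
  proof
    assume ?S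
    from two_switch_restrict[OF mem mem this, OF m] show ?L using restr m by simp
  next
    have sub: "E1 \<subseteq> Pow P" "E2 \<subseteq> Pow Q" using m by (auto dest!: realizations_on_subset_Pow)
    have empty: "e = {}" if "e \<subseteq> P" "e \<subseteq> Q" for e using disj that by blast
    assume ?L
    then show ?S
    proof (elim disjE conjE)
      assume eq: "E1 = E1'" and sw: "two_switch E2 E2'"
      \<comment> \<open>The unchanged part together with \<open>joins\<close> has no nonempty member
        inside \<open>Q\<close>, so \<open>two_switch_extend\<close> applies with \<open>Q\<close>
        as \<open>X\<close>.\<close>
      have "two_switch (E2 \<union> (E1 \<union> joins)) (E2' \<union> (E1 \<union> joins))"
        by (rule two_switch_extend[OF sw sub(2)]) (metis UnE PowD subsetD sub(1) empty joins_disjoint(2))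
      then show ?S by (simp add: eq Un_ac)
    next
      assume eq: "E2 = E2'" and sw: "two_switch E1 E1'"
      have "two_switch (E1 \<union> (E2 \<union> joins)) (E1' \<union> (E2 \<union> joins))"
        by (rule two_switch_extend[OF sw sub(1)]) (metis UnE PowD subsetD sub(2) empty joins_disjoint(1))
      then show ?S by (simp add: eq Un_ac)
    qed
  qed
  ultimately show ?thesis
    unfolding graph_iso_def
    by (intro exI[of _ ?F])
      (auto simp: edge_cart_prod2_iff edge_realization_graph_on_iff mem)
qed

end

section \<open>From vertex sets back to degree sequences\<close>

lemma realization_graph_comp_seq:
  assumes "splitted_seq p"
  shows "realization_graph (comp_seq p q) \<cong>\<^sub>G
    cart_prod2 (realization_graph (splitted_terms p)) (realization_graph q)"
proof -
  obtain p2 p1 where p: "p = (p2, p1)" by fastforce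
  define n2 where "n2 = length p2"
  define m where "m = n2 + length p1"
  \<comment> \<open>\<open>l\<close> is the composed list before sorting, so that \<open>A\<close>,
    \<open>B\<close> and \<open>Q\<close> are consecutive intervals of positions.\<close>
  define l where "l = map (\<lambda>x. x + length q) p2 @ p1 @ map (\<lambda>x. x + length p2) q"
  define A where "A = {..<n2}"
  define B where "B = {n2..<m}"
  define Q where "Q = {m..<length l}"
  have len: "length l = m + length q" by (simp add: l_def m_def n2_def)
  have AB: "A \<union> B = {..<length (p2 @ p1)}" by (auto simp: A_def B_def m_def n2_def)
  have ABQ: "A \<union> B \<union> Q = {..<length l}" unfolding AB by (auto simp: Q_def m_def n2_def len)
  \<comment> \<open>One split realization suffices: it serves to establish \<open>sums\<close>,
    which no longer mentions a realization.\<close>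
  obtain E where E: "E \<in> realizations (p2 @ p1)"
    and cl: "\<And>u v. u < length p2 \<Longrightarrow> v < length p2 \<Longrightarrow> u \<noteq> v \<Longrightarrow> {u, v} \<in> E"
    and ind: "\<And>u v. u \<in> {length p2..<length (p2 @ p1)} \<Longrightarrow> v \<in> {length p2..<length (p2 @ p1)} \<Longrightarrow>
      {u, v} \<notin> E"
    using assms unfolding splitted_seq_def p by auto
  have "E \<in> realizations_on (A \<union> B) ((!) (p2 @ p1))"
    using E unfolding AB realizations_def realizations_on_def by simp
  then have sums: "sum ((!) (p2 @ p1)) A = sum ((!) (p2 @ p1)) B + card A * (card A - 1)"
    by (rule split_degree_sums) (use cl ind in \<open>auto simp: A_def B_def n2_def m_def\<close>)
  interpret composition A B Q "(!) l" "(!) (p2 @ p1)" "\<lambda>i. q ! (i - m)"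
  proof
    show "sum ((!) (p2 @ p1)) A = sum ((!) (p2 @ p1)) B + card A * (card A - 1)" by (fact sums)
  qed (auto simp: A_def B_def Q_def len, auto simp: l_def n2_def m_def nth_append)
  have "bij_betw (\<lambda>i. i - m) Q {..<length q}"
    by (rule bij_betw_byWitness[where f' = "\<lambda>i. i + m"]) (auto simp: Q_def len)
  then have Q: "realization_graph_on Q (\<lambda>i. q ! (i - m)) \<cong>\<^sub>G realization_graph q"
    unfolding realization_graph_eq by (rule realization_graph_on_relabel) simp
  have P: "realization_graph_on (A \<union> B) ((!) (p2 @ p1)) \<cong>\<^sub>G realization_graph (splitted_terms p)"
    unfolding AB realization_graph_eq[symmetric]
    by (rule realization_graph_mset_cong) (simp add: splitted_terms_def p)
  have "realization_graph (comp_seq p q) \<cong>\<^sub>G realization_graph l"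
    by (rule realization_graph_mset_cong) (simp add: comp_seq_def p l_def)
  moreover have "realization_graph l \<cong>\<^sub>G cart_prod2 (realization_graph_on (A \<union> B) ((!) (p2 @ p1)))
      (realization_graph_on Q (\<lambda>i. q ! (i - m)))"
    using graph_iso_sym[OF realization_graph_composition] unfolding ABQ realization_graph_eq .
  ultimately show ?thesis by (rule graph_iso_trans[OF graph_iso_trans[OF _ _] cart_prod2_cong[OF P Q]])
qed

text \<open>Each outermost splitted component contributes one binary factor, which
  \<open>cart_prod_Cons_iso\<close> turns into a new first coordinate.\<close>

lemma realization_graph_foldr_comp_seq:
  assumes "\<forall>\<alpha> \<in> set \<alpha>s. splitted_seq \<alpha>"
  shows "realization_graph (foldr comp_seq \<alpha>s d0) \<cong>\<^sub>G
    cart_prod (map (\<lambda>\<alpha>. realization_graph (splitted_terms \<alpha>)) \<alpha>s @ [realization_graph d0])"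
  using assms
proof (induction \<alpha>s)
  case Nil
  show ?case using cart_prod_single_iso by simp
next
  case (Cons \<alpha> \<alpha>s)
  let ?G = "realization_graph (splitted_terms \<alpha>)"
    and ?Gs = "map (\<lambda>\<alpha>. realization_graph (splitted_terms \<alpha>)) \<alpha>s @ [realization_graph d0]"
  have "realization_graph (foldr comp_seq (\<alpha> # \<alpha>s) d0) \<cong>\<^sub>G
      cart_prod2 ?G (realization_graph (foldr comp_seq \<alpha>s d0))"
    using realization_graph_comp_seq Cons.prems by simp
  moreover have "cart_prod2 ?G (realization_graph (foldr comp_seq \<alpha>s d0)) \<cong>\<^sub>G
      cart_prod2 ?G (cart_prod ?Gs)"
    using Cons by (intro cart_prod2_cong graph_iso_refl) simp
  ultimately have "realization_graph (foldr comp_seq (\<alpha> # \<alpha>s) d0) \<cong>\<^sub>G cart_prod (?G # ?Gs)"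
    by (rule graph_iso_trans[OF graph_iso_trans[OF _ _] cart_prod_Cons_iso])
  then show ?case by simp
qed

theorem theorem3p4:
  fixes d d0 :: "nat list" and \<alpha>s :: "splitted list"
  assumes "degree_seq d"
    and "canonical_decomposition d \<alpha>s d0"
  shows "realization_graph d \<cong>\<^sub>G
    cart_prod (map (\<lambda>\<alpha>. realization_graph (splitted_terms \<alpha>)) \<alpha>s @ [realization_graph d0])"
  using assms realization_graph_foldr_comp_seq
  by (simp add: canonical_decomposition_def indecomposable_splitted_def)

end
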